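(* Let $0<\lambda<2$. A sequence $(x_n)_{n\ge0}$ of nonnegative integers codes the orbit of a real number $x\in[0,\infty)$ under the action of $T_\lambda$ (that is, there exists $x\in[0,\infty)$ with $\omega_\lambda(x)=x_0x_1x_2\ldots$) if and only if $$x_nx_{n+1}x_{n+2}\ldots\prec\omega_\lambda(\infty)\qquad\text{for all } n\ge0 .$$
   Context: For sequences of nonnegative integers, $\prec$ denotes the strict lexicographic order: $\omega\prec\omega'$ if there is $\ell\ge0$ with $\omega_\ell<\omega'_\ell$ and $\omega_j=\omega_j'$ for all $0\le j<\ell$. Fix a real number $0<\lambda<2$. Let $h(y)=\frac{1}{\lambda-y}$ and $h_0(y)=\frac{y}{\lambda y+1}$. Define $m_0^\lambda=0$ and, as long as $m_i^\lambda<\lambda$, $m_{i+1}^\lambda=h(m_i^\lambda)$ (so $m_1^\lambda=1/\lambda$). This sequence is increasing and finite: there is an integer $i_\lambda\ge 1$ with $0=m_0^\lambda<m_1^\lambda<\cdots<m_{i_\lambda-1}^\lambda<\lambda\le m_{i_\lambda}^\lambda<\infty$. For $0\le i<i_\lambda$ set $h_{i+1}=h\circ h_i$. Let $I_i^\lambda=[m_i^\lambda,m_{i+1}^\lambda)$ for $0\le i<i_\lambda$ and $I_{i_\lambda}^\lambda=[m_{i_\lambda}^\lambda,\infty)$; these intervals partition $[0,\infty)$. For $i<i_\lambda$, $h_i$ is an increasing bijection from $[0,\infty)$ onto $I_i^\lambda$; $h_{i_\lambda}$ is an increasing bijection from $[0,\ell_\lambda)$ onto $I_{i_\lambda}^\lambda$,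 where $\ell_\lambda=h_{i_\lambda-1}^{-1}(\lambda)$ if $m_{i_\lambda}^\lambda>\lambda$ and $\ell_\lambda=\infty$ if $m_{i_\lambda}^\lambda=\lambda$. The map $T_\lambda:[0,\infty)\to[0,\infty)$ is defined by $T_\lambda(x)=h_i^{-1}(x)$ for $x\in I_i^\lambda$. Coding: for $x\in[0,\infty)$, $\omega_\lambda(x)=x_0x_1x_2\ldots$, with $x_n\in\{0,\ldots,i_\lambda\}$ the unique index such that $T_\lambda^n(x)\in I_{x_n}^\lambda$. The map $x\mapsto\omega_\lambda(x)$ is non-decreasing for the lexicographic order, and $\omega_\lambda(\infty)=\infty_0\infty_1\infty_2\ldots$ denotes its limit as $x\to\infty$: for each $n$, the word $\infty_0\ldots\infty_n$ is the prefix of length $n+1$ of $\omega_\lambda(x)$ for all sufficiently large real $x$. *)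

theory Defs
  imports Complex_Main "HOL-Library.Fun_Lexorder" "HOL-Library.Extended_Real"
begin

definition h :: "real \<Rightarrow> real \<Rightarrow> real" where
  "h lam y = 1 / (lam - y)"

definition h0 :: "real \<Rightarrow> real \<Rightarrow> real" where
  "h0 lam y = y / (lam * y + 1)"

(* The sequence is only meaningful up to the first index with m lam i >= lam, which is i_last lam;
   later values are artefacts of totality and are never used. *)
primrec m :: "real \<Rightarrow> nat \<Rightarrow> real" where
  "m lam 0 = 0"
| "m lam (Suc i) = h lam (m lam i)"

definition i_last :: "real \<Rightarrow> nat" where
  "i_last lam = (LEAST i. lam \<le> m lam i)"

(* As a map on the domain dom_branch lam i; only used for i <= i_last lam. *)
primrec branch :: "real \<Rightarrow> nat \<Rightarrow> real \<Rightarrow> real" where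
  "branch lam 0 = h0 lam"
| "branch lam (Suc i) = h lam \<circ> branch lam i"

definition interval :: "real \<Rightarrow> nat \<Rightarrow> real set" where
  "interval lam i =
     (if i < i_last lam then {m lam i ..< m lam (Suc i)} else {m lam (i_last lam) ..})"

definition ell :: "real \<Rightarrow> ereal" where
  "ell lam =
     (if m lam (i_last lam) > lam
      then ereal (inv_into {0..} (branch lam (i_last lam - 1)) lam)
      else \<infinity>)"

definition dom_branch :: "real \<Rightarrow> nat \<Rightarrow> real set" where
  "dom_branch lam i =
     (if i < i_last lam then {0..} else {y. 0 \<le> y \<and> ereal y < ell lam})"

definition digit :: "real \<Rightarrow> real \<Rightarrow> nat" where
  "digit lam x = (THE i. i \<le> i_last lam \<and> x \<in> interval lam i)"

definition T :: "real \<Rightarrow> real \<Rightarrow> real" where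
  "T lam x = inv_into (dom_branch lam (digit lam x)) (branch lam (digit lam x)) x"

definition omega :: "real \<Rightarrow> real \<Rightarrow> nat \<Rightarrow> nat" where
  "omega lam x n = digit lam ((T lam ^^ n) x)"

definition omega_infinity :: "real \<Rightarrow> nat \<Rightarrow> nat" where
  "omega_infinity lam =
     (THE w. \<forall>n. \<forall>\<^sub>F x in at_top. \<forall>j\<le>n. omega lam x j = w j)"

end

theory Submission
  imports Defs
begin

text \<open>
The coding turns the dynamics into the shift: $\omega_\lambda(T_\lambda y)$ is the tail of
$\omega_\lambda(y)$. Each branch is an increasing Moebius map of determinant one, so the coding is
monotone; that alone yields the limit word $\omega_\lambda(\infty)$ and the weak inequality
$\omega_\lambda(y) \preceq \omega_\lambda(\infty)$.

Necessity needs the inequality to be strict. As $\omega_\lambda(y+1)$ still lies below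
$\omega_\lambda(\infty)$, it is enough that the coding is injective (\<open>omega_injective\<close>). The map is not
expanding in the coordinate $x$, but in the coordinate $1/x$ it never contracts a pair of points with
the same digit, and whenever that digit is nonzero the gap $g$ between the reciprocals grows to
some $g' \ge g\,(1+g')$ (\<open>reciprocal_gap_grows\<close>). Two distinct points with a common coding would meet
infinitely many nonzero digits, so their gap would grow without bound; but points carrying a nonzero
digit have reciprocals in $(0,\lambda]$.

Sufficiency: to a sequence $x$ attach $\Phi(x)$, the supremum of the points whose coding is at most
$x$. This set is bounded as soon as $x \prec \omega_\lambda(\infty)$. Splitting off the first digit
shows that it consists of everything left of the interval with index $x_0$ together with the image
under the branch $h_{x_0}$ of the corresponding set for the tail $\sigma x$. An increasing bijection
between intervals carries suprema to suprema, so $\Phi(x) = h_{x_0}(\Phi(\sigma x))$, that is,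
$\Phi(x)$ has digit $x_0$ and $T_\lambda(\Phi(x)) = \Phi(\sigma x)$ (\<open>Sup_points_below_step\<close>).
Iterating, $\Phi(x)$ is coded by $x$.
\<close>

section \<open>Denominators of the branches\<close>

text \<open>
Up to sign, these are the entries of the powers of $h$, viewed as matrices: values of Chebyshev
polynomials of the second kind, $\sin(n\theta)/\sin\theta$ for $\lambda = 2\cos\theta$. They are
written $s_n$ in the explanations.
\<close>

fun cheb :: "real \<Rightarrow> nat \<Rightarrow> real" where
  "cheb lam 0 = 0"
| "cheb lam (Suc 0) = 1"
| "cheb lam (Suc (Suc n)) = lam * cheb lam (Suc n) - cheb lam n"

text \<open>
This is the statement that the Moebius maps below have determinant one.
\<close>

lemma cheb_det: "(cheb lam (Suc n))\<^sup>2 - cheb lam n * cheb lam (Suc (Suc n)) = 1"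
proof (induction n)
  case (Suc n)
  have "(cheb lam (Suc (Suc n)))\<^sup>2 - cheb lam (Suc n) * cheb lam (Suc (Suc (Suc n)))
      = (cheb lam (Suc n))\<^sup>2 - cheb lam n * cheb lam (Suc (Suc n))"
    by (simp add: power2_eq_square algebra_simps)
  with Suc show ?case by simp
qed simp

context
  fixes lam :: real
  assumes lam: "0 < lam" "lam < 2"
begin

lemma reaches_lam: "\<exists>i. lam \<le> m lam i"
proof (rule ccontr)
  assume "\<nexists>i. lam \<le> m lam i"
  then have below: "m lam i < lam" for i by (meson not_le)
  \<comment> \<open>$h(y) - y = (1 - \lambda y + y^2)/(\lambda - y)$; for $\lambda < 2$ the numerator has no real
    zero, and its minimum $1 - \lambda^2/4$ over the largest denominator $\lambda$ gives a uniform step.\<close>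
  define d where "d = (1 - lam\<^sup>2 / 4) / lam"
  have "lam\<^sup>2 < 2\<^sup>2" using lam by (intro power_strict_mono) auto
  then have d: "d > 0" using lam by (simp add: d_def)
  have bound: "real i * d \<le> m lam i" for i
  proof (induction i)
    case (Suc i)
    let ?y = "m lam i"
    have y: "0 \<le> ?y" using Suc d by (smt (verit) mult_nonneg_nonneg of_nat_0_le_iff)
    have sq: "1 - lam\<^sup>2 / 4 \<le> 1 - lam * ?y + ?y\<^sup>2"
      using zero_le_power2[of "?y - lam / 2"] by (simp add: power2_eq_square algebra_simps)
    have "d \<le> (1 - lam * ?y + ?y\<^sup>2) / (lam - ?y)"
      unfolding d_def using sq y below[of i] \<open>lam\<^sup>2 < 2\<^sup>2\<close> by (intro frac_le) auto
    also have "\<dots> = 1 / (lam - ?y) - ?y"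
      using below[of i] by (simp add: field_simps power2_eq_square)
    finally show ?case using Suc by (simp add: h_def algebra_simps)
  qed simp
  obtain i where "lam < real i * d" using d reals_Archimedean3 by blast
  with bound[of i] below[of i] show False by simp
qed

lemma lam_le_m_last: "lam \<le> m lam (i_last lam)"
  unfolding i_last_def using reaches_lam by (rule LeastI_ex)

lemma m_less_lam: "i < i_last lam \<Longrightarrow> m lam i < lam"
  unfolding i_last_def using not_less_Least by (metis not_le)

lemma i_last_pos: "0 < i_last lam"
  using lam_le_m_last lam by (cases "i_last lam") auto

lemma cheb_pos_and_m:
  assumes "i \<le> i_last lam"
  shows "0 < cheb lam (Suc i) \<and> m lam i = cheb lam i / cheb lam (Suc i)"
  using assms
proof (induction i)
  case (Suc i)
  then have pos: "0 < cheb lam (Suc i)" and m: "m lam i = cheb lam i / cheb lam (Suc i)"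
    by auto
  have lt: "m lam i < lam" using Suc.prems by (intro m_less_lam) simp
  have eq: "cheb lam (Suc (Suc i)) = cheb lam (Suc i) * (lam - m lam i)"
    using pos by (simp add: m field_simps)
  with pos lt have "0 < cheb lam (Suc (Suc i))" by simp
  moreover have "m lam (Suc i) = cheb lam (Suc i) / cheb lam (Suc (Suc i))"
    unfolding eq using pos lt by (simp add: h_def)
  ultimately show ?case by blast
qed simp

lemma cheb_Suc_pos: "i \<le> i_last lam \<Longrightarrow> 0 < cheb lam (Suc i)"
  using cheb_pos_and_m by blast

lemma cheb_nonneg: "i \<le> Suc (i_last lam) \<Longrightarrow> 0 \<le> cheb lam i"
  using cheb_Suc_pos by (cases i) (auto intro: less_imp_le)

lemma m_eq: "i \<le> i_last lam \<Longrightarrow> m lam i = cheb lam i / cheb lam (Suc i)"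
  using cheb_pos_and_m by blast

text \<open>
The index $i_\lambda + 2$ is thus the first positive one at which the Chebyshev sequence fails to be
positive. The entry there is negative exactly when the last branch has a pole in
$(0,\infty)$, which is what makes its domain bounded.
\<close>

lemma cheb_last: "cheb lam (Suc (Suc (i_last lam))) \<le> 0"
proof -
  have "0 < cheb lam (Suc (i_last lam))" by (simp add: cheb_Suc_pos)
  then show ?thesis
    using lam_le_m_last m_eq[of "i_last lam"] by (simp add: pos_le_divide_eq)
qed

text \<open>
From the determinant identity $s_n^2 = 1 + s_{n-1}s_{n+1}$, both neighbours being nonnegative. This
bound is the source of all expansion. It stops at $i_\lambda$: the next entry is positive but at most
one.
\<close>

lemma cheb_ge_1:
  assumes "0 < i" "i \<le> i_last lam"
  shows "1 \<le> cheb lam i"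
proof -
  obtain k where i: "i = Suc k" using assms by (cases i) auto
  have "0 \<le> cheb lam k * cheb lam (Suc (Suc k))"
    using assms i by (intro mult_nonneg_nonneg cheb_nonneg) auto
  then have "1\<^sup>2 \<le> (cheb lam i)\<^sup>2" using cheb_det[of lam k] i by simp
  moreover have "0 \<le> cheb lam i" using cheb_nonneg[of i] assms by simp
  ultimately show ?thesis by (rule power2_le_imp_le)
qed

lemma m_mono: "i \<le> j \<Longrightarrow> j \<le> i_last lam \<Longrightarrow> m lam i \<le> m lam j"
proof (induction j)
  case (Suc j)
  have "m lam j \<le> m lam (Suc j)"
  proof -
    have "0 < cheb lam (Suc j)" "0 < cheb lam (Suc (Suc j))"
      using Suc.prems cheb_Suc_pos[of j] cheb_Suc_pos[of "Suc j"] by auto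
    then have "cheb lam j / cheb lam (Suc j) \<le> cheb lam (Suc j) / cheb lam (Suc (Suc j))"
      using cheb_det[of lam j] by (simp add: divide_simps power2_eq_square)
    then show ?thesis using Suc.prems m_eq[of j] m_eq[of "Suc j"] by simp
  qed
  with Suc show ?case by (cases "i = Suc j") auto
qed simp

section \<open>The branches as Moebius maps\<close>

text \<open>
Cleared of denominators, the interval conditions take one form for all indices: for the last one the
upper condition holds automatically because its coefficient is nonpositive.
\<close>

lemma interval_iff:
  assumes "i \<le> i_last lam"
  shows "x \<in> interval lam i \<longleftrightarrow>
    0 \<le> x \<and> cheb lam i \<le> cheb lam (Suc i) * x \<and> cheb lam (Suc (Suc i)) * x < cheb lam (Suc i)"
proof -
  have pos: "0 < cheb lam (Suc i)" using assms by (rule cheb_Suc_pos)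
  have m: "m lam i = cheb lam i / cheb lam (Suc i)" using assms by (rule m_eq)
  have lower: "m lam i \<le> x \<longleftrightarrow> cheb lam i \<le> cheb lam (Suc i) * x"
    using pos by (simp add: m pos_divide_le_eq mult.commute)
  have m0: "0 \<le> m lam i" using m_mono[of 0 i] assms by simp
  show ?thesis
  proof (cases "i < i_last lam")
    case True
    then have "0 < cheb lam (Suc (Suc i))" using cheb_Suc_pos[of "Suc i"] by simp
    then have "x < m lam (Suc i) \<longleftrightarrow> cheb lam (Suc (Suc i)) * x < cheb lam (Suc i)"
      using True m_eq[of "Suc i"] by (simp add: pos_less_divide_eq mult.commute)
    with True lower m0 show ?thesis by (auto simp: interval_def simp del: m.simps)
  next
    case False
    with assms have i: "i = i_last lam" by simp
    have "cheb lam (Suc (Suc i)) * x < cheb lam (Suc i)" if "0 \<le> x"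
      using cheb_last that pos mult_nonpos_nonneg[of "cheb lam (Suc (Suc i))" x]
      unfolding i by linarith
    with i lower m0 show ?thesis by (auto simp: interval_def)
  qed
qed

lemma branch_eq:
  assumes "i \<le> i_last lam" "0 \<le> y"
  shows "branch lam i y =
    (cheb lam (Suc i) * y + cheb lam i) / (cheb lam (Suc (Suc i)) * y + cheb lam (Suc i))"
  using assms
proof (induction i)
  case (Suc i)
  let ?D = "cheb lam (Suc (Suc i)) * y + cheb lam (Suc i)"
  let ?N = "cheb lam (Suc i) * y + cheb lam i"
  have "0 < ?D"
    using Suc.prems cheb_Suc_pos[of i] cheb_Suc_pos[of "Suc i"]
    by (intro add_nonneg_pos mult_nonneg_nonneg) auto
  then have "branch lam (Suc i) y = 1 / (lam - ?N / ?D)"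
    using Suc by (simp add: h_def)
  also have "\<dots> = ?D / (lam * ?D - ?N)"
    using \<open>0 < ?D\<close> by (simp add: diff_divide_distrib[symmetric] divide_simps)
  also have "lam * ?D - ?N = cheb lam (Suc (Suc (Suc i))) * y + cheb lam (Suc (Suc i))"
    by (simp add: algebra_simps)
  finally show ?case .
qed (simp add: h0_def)

text \<open>
The domain of a branch is the set of nonnegative points before its pole; see
\<open>dom_branch_iff\<close>. In this form the last branch needs no separate treatment.
\<close>

definition in_dom :: "nat \<Rightarrow> real \<Rightarrow> bool" where
  "in_dom i y \<longleftrightarrow> 0 \<le> y \<and> 0 < cheb lam (Suc (Suc i)) * y + cheb lam (Suc i)"

lemma moebius_inverse:
  fixes p q r x :: real
  assumes "q\<^sup>2 - p * r = 1" "q - r * x > 0"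
  shows "r * ((q * x - p) / (q - r * x)) + q = 1 / (q - r * x)"
    and "(q * ((q * x - p) / (q - r * x)) + p) / (r * ((q * x - p) / (q - r * x)) + q) = x"
proof -
  have "r * ((q * x - p) / (q - r * x)) + q = (q\<^sup>2 - p * r) / (q - r * x)"
    using assms(2) by (simp add: divide_simps power2_eq_square algebra_simps)
  then show den: "r * ((q * x - p) / (q - r * x)) + q = 1 / (q - r * x)"
    using assms(1) by simp
  have "q * ((q * x - p) / (q - r * x)) + p = (q\<^sup>2 - p * r) * x / (q - r * x)"
    using assms(2) by (simp add: divide_simps power2_eq_square algebra_simps)
  then show "(q * ((q * x - p) / (q - r * x)) + p) / (r * ((q * x - p) / (q - r * x)) + q) = x"
    unfolding den using assms by simp
qed

lemma branch_onto:
  assumes "i \<le> i_last lam" "x \<in> interval lam i"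
  obtains y where "in_dom i y" "branch lam i y = x"
proof
  \<comment> \<open>The inverse of a matrix of determinant one.\<close>
  define y where
    "y = (cheb lam (Suc i) * x - cheb lam i) / (cheb lam (Suc i) - cheb lam (Suc (Suc i)) * x)"
  have x: "cheb lam i \<le> cheb lam (Suc i) * x"
    and D: "0 < cheb lam (Suc i) - cheb lam (Suc (Suc i)) * x"
    using assms interval_iff by auto
  note inverse = moebius_inverse[OF cheb_det D, folded y_def]
  have "0 \<le> y" unfolding y_def using x D by simp
  then show "in_dom i y" unfolding in_dom_def inverse(1) using D by simp
  show "branch lam i y = x"
    using inverse(2) unfolding branch_eq[OF assms(1) \<open>0 \<le> y\<close>] .
qed

lemma branch_diff:
  assumes "i \<le> i_last lam" "in_dom i y" "in_dom i z"
  shows "branch lam i z - branch lam i y = (z - y) /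
    ((cheb lam (Suc (Suc i)) * z + cheb lam (Suc i)) * (cheb lam (Suc (Suc i)) * y + cheb lam (Suc i)))"
proof -
  let ?q = "cheb lam (Suc i)" and ?p = "cheb lam i" and ?r = "cheb lam (Suc (Suc i))"
  have D: "?r * z + ?q \<noteq> 0" "?r * y + ?q \<noteq> 0" and nn: "0 \<le> y" "0 \<le> z"
    using assms by (auto simp: in_dom_def)
  have "branch lam i z - branch lam i y =
      (?q\<^sup>2 - ?p * ?r) * (z - y) / ((?r * z + ?q) * (?r * y + ?q))"
    using D unfolding branch_eq[OF assms(1) nn(1)] branch_eq[OF assms(1) nn(2)]
    by (simp add: diff_frac_eq power2_eq_square algebra_simps del: cheb.simps)
  then show ?thesis by (simp only: cheb_det mult_1)
qed

lemma branch_strict_mono: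
  assumes "i \<le> i_last lam" "in_dom i y" "in_dom i z" "y < z"
  shows "branch lam i y < branch lam i z"
proof -
  have "0 < branch lam i z - branch lam i y"
    unfolding branch_diff[OF assms(1-3)] using assms by (simp add: in_dom_def del: cheb.simps)
  then show ?thesis by simp
qed

lemma branch_less_iff:
  assumes "i \<le> i_last lam" "in_dom i y" "in_dom i z"
  shows "branch lam i y < branch lam i z \<longleftrightarrow> y < z"
  by (metis assms branch_strict_mono linorder_less_linear order_less_asym)

lemma branch_in_interval:
  assumes "i \<le> i_last lam" "in_dom i y"
  shows "branch lam i y \<in> interval lam i"
proof -
  let ?q = "cheb lam (Suc i)" and ?p = "cheb lam i" and ?r = "cheb lam (Suc (Suc i))"
  have y: "0 \<le> y" and D: "0 < ?r * y + ?q" using assms by (auto simp: in_dom_def)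
  have q: "0 < ?q" and p: "0 \<le> ?p" using assms cheb_Suc_pos cheb_nonneg by auto
  have det: "?q * ?q - ?p * ?r = 1" using cheb_det[of lam i] by (simp add: power2_eq_square)
  have "?p * (?r * y + ?q) \<le> ?q * (?q * y + ?p)"
  proof -
    have "?q * (?q * y + ?p) - ?p * (?r * y + ?q) = (?q * ?q - ?p * ?r) * y"
      by (simp add: algebra_simps del: cheb.simps)
    then show ?thesis using y by (simp only: det)
  qed
  moreover have "?r * (?q * y + ?p) < ?q * (?r * y + ?q)"
  proof -
    have "?q * (?r * y + ?q) - ?r * (?q * y + ?p) = ?q * ?q - ?p * ?r"
      by (simp add: algebra_simps del: cheb.simps)
    then show ?thesis by (simp only: det)
  qed
  moreover have "0 \<le> ?q * y + ?p" using q p y by simp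
  ultimately show ?thesis
    using D by (simp add: interval_iff[OF assms(1)] branch_eq[OF assms(1) y]
        pos_le_divide_eq pos_divide_less_eq del: cheb.simps)
qed

lemma dom_branch_iff:
  assumes "i \<le> i_last lam"
  shows "y \<in> dom_branch lam i \<longleftrightarrow> in_dom i y"
proof (cases "i < i_last lam")
  case True
  then have "0 < cheb lam (Suc i)" "0 < cheb lam (Suc (Suc i))"
    using cheb_Suc_pos[of i] cheb_Suc_pos[of "Suc i"] by auto
  then show ?thesis using True
    by (auto simp: dom_branch_def in_dom_def add_nonneg_pos simp del: cheb.simps)
next
  case False
  then have i: "i = i_last lam" using assms by simp
  let ?q = "cheb lam (Suc i)" and ?p = "cheb lam i" and ?r = "cheb lam (Suc (Suc i))"
  have q: "0 < ?q" using assms by (rule cheb_Suc_pos)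
  have mi: "m lam i = ?p / ?q" using assms by (rule m_eq)
  obtain k where k: "i = Suc k" using i_last_pos i by (metis not0_implies_Suc less_irrefl)
  have kle: "k \<le> i_last lam" using k i by simp
  have p: "0 < ?p" using cheb_Suc_pos[OF kle] k by simp
  show ?thesis
  proof (cases "lam < m lam i")
    case True
    then have r: "?r < 0" using q by (simp add: mi pos_less_divide_eq)
    have dom_k: "in_dom k y \<longleftrightarrow> 0 \<le> y" for y
      using p q k by (auto simp: in_dom_def add_nonneg_pos simp del: cheb.simps)
    \<comment> \<open>The pole of the last branch is the point that the previous branch sends to $\lambda$.\<close>
    define e where "e = - ?q / ?r"
    have e: "0 \<le> e" using q r unfolding e_def by (simp add: divide_nonneg_neg divide_simps del: cheb.simps)
    have inj: "inj_on (branch lam k) {0..}"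
      by (rule inj_onI) (metis atLeast_iff dom_k branch_strict_mono[OF kle] less_irrefl linorder_less_linear)
    have "branch lam k e = lam"
    proof -
      have De: "0 < ?q * e + ?p" using p q e by (simp add: add_nonneg_pos)
      have "?r * e = - ?q" using r by (simp add: e_def del: cheb.simps)
      then have "lam * (?q * e + ?p) = ?p * e + cheb lam k"
        by (simp add: k algebra_simps)
      then have "(?p * e + cheb lam k) / (?q * e + ?p) = lam"
        using De by (simp add: nonzero_divide_eq_eq del: cheb.simps)
      then show ?thesis unfolding branch_eq[OF kle e] k .
    qed
    then have "inv_into {0..} (branch lam k) lam = e"
      using inj e by (metis atLeast_iff inv_into_f_f)
    moreover have "i_last lam - 1 = k" using i k by simp
    ultimately have "ell lam = ereal e"
      using True i unfolding ell_def by (simp only: if_True)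
    then have "y \<in> dom_branch lam i \<longleftrightarrow> 0 \<le> y \<and> y < e" using i by (simp add: dom_branch_def)
    also have "y < e \<longleftrightarrow> 0 < ?r * y + ?q"
      unfolding e_def neg_less_divide_eq[OF r] by (simp only: mult.commute[of y]) linarith
    finally show ?thesis by (simp add: in_dom_def)
  next
    case False
    then have "m lam i = lam" using lam_le_m_last i by simp
    then have "?r = 0" using q by (simp add: mi divide_simps)
    moreover have "ell lam = \<infinity>" using False i by (simp add: ell_def)
    ultimately show ?thesis using i q by (simp add: dom_branch_def in_dom_def del: cheb.simps)
  qed
qed

section \<open>The digit and the map\<close>

lemma interval_less:
  assumes "i < j" "j \<le> i_last lam" "x \<in> interval lam i" "y \<in> interval lam j"
  shows "x < y"
proof -
  have "x < m lam (Suc i)" using assms by (simp add: interval_def del: m.simps)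
  also have "\<dots> \<le> m lam j" using assms by (intro m_mono) auto
  also have "\<dots> \<le> y" using assms by (auto simp: interval_def split: if_splits simp del: m.simps)
  finally show ?thesis .
qed

lemma interval_covers:
  assumes "0 \<le> x"
  shows "\<exists>i\<le>i_last lam. x \<in> interval lam i"
proof -
  let ?P = "\<lambda>i. cheb lam (Suc (Suc i)) * x < cheb lam (Suc i)"
  have "?P (i_last lam)"
    using cheb_last cheb_Suc_pos[of "i_last lam"] assms
      mult_nonpos_nonneg[of "cheb lam (Suc (Suc (i_last lam)))" x] by linarith
  \<comment> \<open>For the least such index, the failed upper condition one step earlier is the lower condition.\<close>
  then obtain i where i: "?P i" "\<And>j. j < i \<Longrightarrow> \<not> ?P j" "i \<le> i_last lam"
    using exists_least_iff[of ?P] by (metis linorder_not_le)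
  have "cheb lam i \<le> cheb lam (Suc i) * x"
    using i(2)[of "i - 1"] assms by (cases i) auto
  with i assms interval_iff show ?thesis by auto
qed

lemma digit_eqI:
  assumes "i \<le> i_last lam" "x \<in> interval lam i"
  shows "digit lam x = i"
  unfolding digit_def
proof (rule the_equality)
  fix j assume "j \<le> i_last lam \<and> x \<in> interval lam j"
  then show "j = i"
    using assms interval_less by (metis less_irrefl linorder_less_linear)
qed (use assms in simp)

lemma digit_props:
  assumes "0 \<le> x"
  shows "digit lam x \<le> i_last lam" "x \<in> interval lam (digit lam x)"
  using interval_covers[OF assms] digit_eqI by auto

lemma digit_mono:
  assumes "0 \<le> x" "x \<le> y"
  shows "digit lam x \<le> digit lam y"
  using interval_less[of "digit lam y" "digit lam x" y x] digit_props[of x] digit_props[of y] assms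
  by force

lemma T_branch:
  assumes "i \<le> i_last lam" "in_dom i y"
  shows "digit lam (branch lam i y) = i" "T lam (branch lam i y) = y"
proof -
  show d: "digit lam (branch lam i y) = i"
    using assms by (intro digit_eqI branch_in_interval)
  have "inj_on (branch lam i) (dom_branch lam i)"
    by (rule inj_onI)
      (metis assms(1) branch_strict_mono dom_branch_iff less_irrefl linorder_less_linear)
  then show "T lam (branch lam i y) = y"
    unfolding T_def d using assms dom_branch_iff by simp
qed

lemma branch_T:
  assumes "0 \<le> x"
  shows "in_dom (digit lam x) (T lam x)" "branch lam (digit lam x) (T lam x) = x"
proof -
  note d = digit_props[OF assms]
  obtain y where y: "in_dom (digit lam x) y" "branch lam (digit lam x) y = x"
    by (rule branch_onto[OF d])
  then have "T lam x = y" using T_branch(2)[OF d(1) y(1)] by simp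
  with y show "in_dom (digit lam x) (T lam x)" "branch lam (digit lam x) (T lam x) = x" by simp_all
qed

lemma T_nonneg: "0 \<le> x \<Longrightarrow> 0 \<le> T lam x"
  using branch_T by (simp add: in_dom_def)

lemma T_less:
  assumes "0 \<le> x" "x < y" "digit lam x = digit lam y"
  shows "T lam x < T lam y"
  using branch_T[of x] branch_T[of y] assms digit_props[of x] branch_less_iff
  by (metis order_trans order_less_imp_le)

lemma digit_zero: "digit lam 0 = 0" and T_zero: "T lam 0 = 0"
proof -
  have "in_dom 0 0" by (simp add: in_dom_def)
  moreover have "branch lam 0 0 = 0" by (simp add: h0_def)
  ultimately show "digit lam 0 = 0" "T lam 0 = 0" using T_branch[of 0 0] by auto
qed

section \<open>Codings are monotone\<close>

abbreviation lex_le :: "(nat \<Rightarrow> nat) \<Rightarrow> (nat \<Rightarrow> nat) \<Rightarrow> bool" where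
  "lex_le u v \<equiv> less_fun u v \<or> u = v"

lemma lex_total: "less_fun u v \<or> u = v \<or> less_fun v u" for u v :: "nat \<Rightarrow> nat"
proof (cases "u = v")
  case False
  then obtain k where "u k \<noteq> v k" "\<And>j. j < k \<Longrightarrow> u j = v j"
    using exists_least_iff[of "\<lambda>k. u k \<noteq> v k"] by auto
  then show ?thesis unfolding less_fun_def by (metis linorder_neqE_nat)
qed simp

lemma less_fun_head_tail:
  "less_fun u v \<longleftrightarrow> u 0 < v 0 \<or> u 0 = v 0 \<and> less_fun (\<lambda>k. u (Suc k)) (\<lambda>k. v (Suc k))"
  for u v :: "nat \<Rightarrow> nat"
proof
  assume "less_fun u v"
  then obtain k where k: "u k < v k" "\<forall>j<k. u j = v j" unfolding less_fun_def by blast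
  then show "u 0 < v 0 \<or> u 0 = v 0 \<and> less_fun (\<lambda>k. u (Suc k)) (\<lambda>k. v (Suc k))"
    unfolding less_fun_def by (cases k) auto
next
  assume "u 0 < v 0 \<or> u 0 = v 0 \<and> less_fun (\<lambda>k. u (Suc k)) (\<lambda>k. v (Suc k))"
  then show "less_fun u v"
  proof
    assume "u 0 < v 0"
    then show ?thesis unfolding less_fun_def by (intro exI[of _ 0]) auto
  next
    assume *: "u 0 = v 0 \<and> less_fun (\<lambda>k. u (Suc k)) (\<lambda>k. v (Suc k))"
    then obtain k where "u (Suc k) < v (Suc k)" "\<forall>j<k. u (Suc j) = v (Suc j)"
      unfolding less_fun_def by blast
    with * show ?thesis
      unfolding less_fun_def by (intro exI[of _ "Suc k"]) (auto simp: less_Suc_eq_0_disj)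
  qed
qed

lemma lex_le_head_tail:
  "lex_le u v \<longleftrightarrow> u 0 < v 0 \<or> u 0 = v 0 \<and> lex_le (\<lambda>k. u (Suc k)) (\<lambda>k. v (Suc k))"
  for u v :: "nat \<Rightarrow> nat"
proof -
  have "u = v \<longleftrightarrow> u 0 = v 0 \<and> (\<lambda>k. u (Suc k)) = (\<lambda>k. v (Suc k))"
    unfolding fun_eq_iff by (metis not0_implies_Suc)
  then show ?thesis using less_fun_head_tail[of u v] by blast
qed

text \<open>
Strict inequality survives passing to a limit of words when it is already decided at a position up to
which the limit agrees with the approximating word.
\<close>

lemma less_fun_prefix_limit:
  fixes u v v' w :: "nat \<Rightarrow> nat"
  assumes "u l < v l" "\<And>j. j < l \<Longrightarrow> u j = v j" "lex_le v v'" "\<And>j. j \<le> l \<Longrightarrow> v' j = w j"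
  shows "less_fun u w"
  using assms(3)
proof
  assume "less_fun v v'"
  then obtain k where k: "v k < v' k" "\<forall>j<k. v j = v' j" unfolding less_fun_def by blast
  show ?thesis unfolding less_fun_def
  proof (intro exI[of _ "min k l"] conjI allI impI)
    show "u (min k l) < w (min k l)"
      using assms(1,2,4) k by (cases k l rule: linorder_cases) (force simp: min_def)+
    show "u j = w j" if "j < min k l" for j using that assms(2,4) k by auto
  qed
next
  assume "v = v'"
  then show ?thesis unfolding less_fun_def using assms by (metis less_imp_le order_refl)
qed

lemma orbit_nonneg: "0 \<le> y \<Longrightarrow> 0 \<le> (T lam ^^ n) y"
  by (induction n) (auto intro: T_nonneg)

lemma omega_0: "omega lam y 0 = digit lam y"
  by (simp add: omega_def)

lemma omega_orbit: "omega lam ((T lam ^^ n) y) k = omega lam y (n + k)"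
  by (simp add: omega_def add.commute[of n k] funpow_add)

lemma omega_Suc: "omega lam y (Suc n) = omega lam (T lam y) n"
  using omega_orbit[of 1 y n] by simp

lemma orbit_less:
  assumes "0 \<le> y" "y < z" "\<And>j. j < n \<Longrightarrow> omega lam y j = omega lam z j"
  shows "(T lam ^^ n) y < (T lam ^^ n) z"
  using assms(3)
proof (induction n)
  case (Suc n)
  have "digit lam ((T lam ^^ n) y) = digit lam ((T lam ^^ n) z)"
    using Suc.prems[of n] by (simp add: omega_def)
  then show ?case using Suc T_less[of "(T lam ^^ n) y"] orbit_nonneg assms(1) by simp
qed (use assms in simp)

lemma omega_mono:
  assumes "0 \<le> y" "y \<le> z"
  shows "lex_le (omega lam y) (omega lam z)"
proof (rule ccontr)
  assume "\<not> ?thesis"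
  then have "less_fun (omega lam z) (omega lam y)" using lex_total by blast
  then obtain k where k: "omega lam z k < omega lam y k" "\<forall>j<k. omega lam z j = omega lam y j"
    unfolding less_fun_def by blast
  then have "y < z" using assms by (cases "y = z") auto
  then have "(T lam ^^ k) y < (T lam ^^ k) z" using assms k by (intro orbit_less) auto
  then have "omega lam y k \<le> omega lam z k"
    unfolding omega_def using orbit_nonneg assms(1) by (intro digit_mono) auto
  with k show False by simp
qed

section \<open>Codings determine points\<close>

text \<open>
With $q = 1/y$, the derivative of the map in reciprocal coordinates at the image of $y$ is the square
of $s_{i+1} + s_i q$. For the inner branches $s_{i+1} \ge 1$ suffices. For the last one $s_{i+1} \le 1$,
with an elliptic branch if the inequality is strict, so far out in $[0,\infty)$ the bound can fail;
it is the restriction to points before the pole that saves it: there the factor is at least $1/s_{i+1}$.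
\<close>

lemma expansion_factor:
  assumes "i \<le> i_last lam" "in_dom i y" "0 < y"
  shows "1 \<le> cheb lam (Suc i) + cheb lam i / y"
proof (cases "i < i_last lam")
  case True
  then have "1 \<le> cheb lam (Suc i)" "0 \<le> cheb lam i" using cheb_ge_1[of "Suc i"] cheb_nonneg[of i] by auto
  then show ?thesis using assms(3) by (simp add: add_increasing2 del: cheb.simps)
next
  case False
  then have i: "i = i_last lam" using assms by simp
  let ?q = "cheb lam (Suc i)" and ?p = "cheb lam i" and ?r = "cheb lam (Suc (Suc i))"
  have q: "0 < ?q" and p: "0 \<le> ?p" using assms cheb_Suc_pos cheb_nonneg by auto
  have r: "?r \<le> 0" using cheb_last i by simp
  have det: "?q\<^sup>2 = 1 + ?p * ?r" using cheb_det[of lam i] by simp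
  have "?q\<^sup>2 \<le> 1" using p r by (simp add: det mult_nonneg_nonpos del: cheb.simps)
  then have q1: "?q \<le> 1" using q by (simp add: power2_le_iff_abs_le abs_square_le_1 del: cheb.simps)
  have "- ?r \<le> ?q / y"
    using assms by (simp add: in_dom_def pos_le_divide_eq del: cheb.simps)
  then have "?p * - ?r \<le> ?p * (?q / y)" using p by (rule mult_left_mono)
  then have "1 \<le> ?q * (?q + ?p / y)"
    using det by (simp add: power2_eq_square algebra_simps del: cheb.simps)
  also have "\<dots> \<le> 1 * (?q + ?p / y)" using q1 q p assms(3) by (intro mult_right_mono) auto
  finally show ?thesis by simp
qed

text \<open>
By the determinant identity, the reciprocal gap is multiplied by exactly $A\,(A + s_i g')$, where
$A = s_{i+1} + s_i / T_\lambda(z) \ge 1$. For a nonzero digit the second factor exceeds $A$ by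
at least the new gap itself, which makes up for $A$ being possibly close to one.
\<close>

lemma reciprocal_gap_grows:
  assumes "0 \<le> y" "y < z" "digit lam y = i" "digit lam z = i" "0 < T lam y"
  defines "g \<equiv> 1 / y - 1 / z" and "g' \<equiv> 1 / T lam y - 1 / T lam z"
  shows "0 < y" and "0 < g" and "g * (1 + cheb lam i * g') \<le> g'"
proof -
  let ?q = "cheb lam (Suc i)" and ?p = "cheb lam i" and ?r = "cheb lam (Suc (Suc i))"
  define Y Z where "Y = T lam y" and "Z = T lam z"
  have i: "i \<le> i_last lam" using digit_props assms by blast
  have YZ: "0 < Y" "Y < Z" using T_less[of y z] assms by (auto simp: Y_def Z_def)
  have dom: "in_dom i Y" "in_dom i Z" and yz: "y = branch lam i Y" "z = branch lam i Z"
    using branch_T[of y] branch_T[of z] assms by (auto simp: Y_def Z_def)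
  have D: "0 < ?r * Y + ?q" "0 < ?r * Z + ?q" using dom by (auto simp: in_dom_def)
  have q: "0 < ?q" and p: "0 \<le> ?p" using i cheb_Suc_pos cheb_nonneg by auto
  have N: "0 < ?q * Y + ?p" "0 < ?q * Z + ?p" using q p YZ by (simp_all add: add_pos_nonneg)
  have y: "y = (?q * Y + ?p) / (?r * Y + ?q)" and z: "z = (?q * Z + ?p) / (?r * Z + ?q)"
    using branch_eq[OF i] YZ yz by auto
  show "0 < y" unfolding y using N D by (simp del: cheb.simps)
  then show "0 < g" using assms by (simp add: g_def frac_less2)
  define A where "A = ?q + ?p / Z"
  have A: "1 \<le> A" unfolding A_def using expansion_factor[OF i dom(2)] YZ by simp
  have g': "g' = 1 / Y - 1 / Z" by (simp add: g'_def Y_def Z_def)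
  have g'0: "0 < g'" using YZ by (simp add: g' frac_less2)
  have "g = (?q\<^sup>2 - ?p * ?r) * (Z - Y) / ((?q * Y + ?p) * (?q * Z + ?p))"
    unfolding g_def y z using N D
    by (simp add: diff_frac_eq power2_eq_square algebra_simps del: cheb.simps)
  also have "\<dots> = (Z - Y) / ((?q * Y + ?p) * (?q * Z + ?p))"
    by (simp only: cheb_det mult_1)
  also have "?q * Z + ?p = Z * A" using YZ by (simp add: A_def field_simps del: cheb.simps)
  also have "?q * Y + ?p = Y * (A + ?p * g')"
    using YZ by (simp add: A_def g' field_simps del: cheb.simps)
  also have "Z - Y = g' * (Y * Z)" using YZ by (simp add: g' field_simps)
  finally have "g = g' * (Y * Z) / (Y * (A + ?p * g') * (Z * A))" .
  moreover have "u * (Y * Z) / (Y * b * (Z * A)) = u / (A * b)" for u b :: real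
    using YZ A by (cases "b = 0") (auto simp: field_simps)
  ultimately have g: "g = g' / (A * (A + ?p * g'))" by simp
  have "0 < A * (A + ?p * g')" using A p g'0 by (intro mult_pos_pos add_pos_nonneg) auto
  then have "g * (A * (A + ?p * g')) = g'"
    unfolding g by (intro nonzero_eq_divide_eq[THEN iffD1] refl) (rule less_imp_neq[symmetric])
  moreover have "1 * (1 + ?p * g') \<le> A * (A + ?p * g')"
    using A p g'0 by (intro mult_mono add_right_mono) auto
  then have "g * (1 + ?p * g') \<le> g * (A * (A + ?p * g'))"
    using \<open>0 < g\<close> by (intro mult_left_mono) auto
  ultimately show "g * (1 + ?p * g') \<le> g'" by simp
qed

text \<open>
While the digit is zero, the map subtracts $\lambda$ from the positive reciprocal, so this happens
only finitely often in a row.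
\<close>

lemma omega_eventually_nonzero:
  assumes "0 < z"
  shows "\<exists>n. omega lam z n \<noteq> 0"
proof (rule ccontr)
  assume "\<not> ?thesis"
  then have zero: "digit lam ((T lam ^^ n) z) = 0" for n by (simp add: omega_def)
  have "0 < (T lam ^^ n) z \<and> 1 / (T lam ^^ n) z = 1 / z - real n * lam" for n
  proof (induction n)
    case (Suc n)
    let ?x = "(T lam ^^ n) z"
    have y: "0 \<le> T lam ?x" and x: "?x = h0 lam (T lam ?x)"
      using branch_T[of ?x] zero[of n] Suc by (auto simp: in_dom_def)
    have pos: "0 < T lam ?x" using y x Suc by (cases "T lam ?x = 0") (auto simp: h0_def)
    have "1 / ?x = lam + 1 / T lam ?x"
      using pos lam by (subst x) (simp add: h0_def field_simps)
    with Suc pos show ?case by (simp add: algebra_simps)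
  qed (use assms in simp)
  then have "0 < 1 / z - real n * lam" for n by (metis zero_less_divide_1_iff)
  moreover obtain n where "1 / z < real n * lam" using lam reals_Archimedean3 by blast
  ultimately show False by (smt (verit))
qed

lemma omega_0_const: "omega lam 0 n = 0"
  by (induction n) (auto simp: omega_0 omega_Suc digit_zero T_zero)

lemma omega_injective:
  assumes "0 \<le> y" "y < z"
  shows "omega lam y \<noteq> omega lam z"
proof
  assume eq: "omega lam y = omega lam z"
  define Y Z where "Y n = (T lam ^^ n) y" and "Z n = (T lam ^^ n) z" for n
  define g where "g n = 1 / Y n - 1 / Z n" for n
  have Y0: "0 \<le> Y n" and YZ: "Y n < Z n" for n
    using orbit_nonneg orbit_less[OF assms] assms eq by (auto simp: Y_def Z_def)
  have nonzero: "\<exists>k\<ge>n. omega lam y k \<noteq> 0" for n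
  proof -
    obtain k where "omega lam (Z n) k \<noteq> 0"
      using omega_eventually_nonzero[of "Z n"] Y0[of n] YZ[of n] by fastforce
    then have "omega lam y (n + k) \<noteq> 0" by (simp add: Z_def omega_orbit eq)
    then show ?thesis using le_add1 by blast
  qed
  \<comment> \<open>If the lower orbit hit zero, the upper one would share its digits, which are all zero.\<close>
  have Ypos: "0 < Y n" for n
  proof (rule ccontr)
    assume "\<not> 0 < Y n"
    then have "Y n = 0" using Y0[of n] by simp
    then have "omega lam y (n + k) = 0" for k
      using omega_0_const[of k] by (metis Y_def omega_orbit)
    then show False using nonzero[of n] le_Suc_ex by metis
  qed
  have dig: "digit lam (Y n) = omega lam y n" "digit lam (Z n) = omega lam y n" for n
    using omega_orbit[of n _ 0] by (simp_all add: Y_def Z_def omega_0 eq)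
  have TY: "T lam (Y n) = Y (Suc n)" "T lam (Z n) = Z (Suc n)" for n
    by (simp_all add: Y_def Z_def)
  have gpos: "0 < g n" and step: "g n * (1 + cheb lam (omega lam y n) * g (Suc n)) \<le> g (Suc n)" for n
    using reciprocal_gap_grows[OF Y0[of n] YZ[of n] dig[of n]] Ypos[of "Suc n"]
    by (simp_all add: TY g_def)
  have dig_le: "omega lam y n \<le> i_last lam" for n using digit_props(1)[OF Y0[of n]] dig by simp
  have "g n \<le> g (Suc n)" for n
  proof -
    have "0 \<le> cheb lam (omega lam y n) * g (Suc n)"
      using cheb_nonneg[of "omega lam y n"] dig_le[of n] gpos[of "Suc n"] by simp
    then have "g n * 1 \<le> g n * (1 + cheb lam (omega lam y n) * g (Suc n))"
      using gpos[of n] by (intro mult_left_mono) auto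
    with step[of n] show ?thesis by simp
  qed
  then have mono: "g a \<le> g b" if "a \<le> b" for a b using that lift_Suc_mono_le by blast
  have grow: "(g 0)\<^sup>2 \<le> g (Suc n) - g n" if "omega lam y n \<noteq> 0" for n
  proof -
    have "1 \<le> cheb lam (omega lam y n)" using that dig_le by (intro cheb_ge_1) auto
    then have "1 * g 0 \<le> cheb lam (omega lam y n) * g (Suc n)"
      using mono[of 0 "Suc n"] gpos[of 0] by (intro mult_mono) auto
    then have "g 0 * g 0 \<le> g n * (cheb lam (omega lam y n) * g (Suc n))"
      using mono[of 0 n] gpos[of 0] by (intro mult_mono) auto
    then show ?thesis using step[of n] by (simp add: power2_eq_square algebra_simps)
  qed
  have "\<exists>n. real k * (g 0)\<^sup>2 \<le> g n" for k
  proof (induction k)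
    case 0
    show ?case using gpos[of 0] by (intro exI[of _ 0]) simp
  next
    case (Suc k)
    then obtain n where n: "real k * (g 0)\<^sup>2 \<le> g n" by blast
    obtain a where a: "n \<le> a" "omega lam y a \<noteq> 0" using nonzero by blast
    have "real (Suc k) * (g 0)\<^sup>2 \<le> g (Suc a)"
      using n mono[OF a(1)] grow[OF a(2)] by (simp add: algebra_simps)
    then show ?case by blast
  qed
  moreover obtain k where "lam < real k * (g 0)\<^sup>2"
    using gpos[of 0] reals_Archimedean3[of "(g 0)\<^sup>2"] by (auto simp: zero_less_power)
  ultimately obtain n where "lam < g n" by (metis less_le_trans)
  moreover obtain a where a: "n \<le> a" "omega lam y a \<noteq> 0" using nonzero by blast
  ultimately have "lam < g a" using mono by fastforce
  \<comment> \<open>A nonzero digit puts the points to the right of $m_1 = 1/\lambda$.\<close>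
  moreover have "g a < lam"
  proof -
    have "m lam 1 \<le> m lam (omega lam y a)" using a(2) dig_le by (intro m_mono) auto
    also have "\<dots> \<le> Y a"
      using digit_props(2)[OF Y0[of a]] dig[of a] dig_le[of a]
      by (auto simp: interval_def split: if_splits)
    finally have "1 / lam \<le> Y a" by (simp add: h_def)
    then have "1 / Y a \<le> lam" using lam Ypos[of a] by (simp add: field_simps)
    moreover have "0 < 1 / Z a" using Ypos[of a] YZ[of a] by simp
    ultimately show ?thesis unfolding g_def by linarith
  qed
  ultimately show False by simp
qed

lemma omega_strict_mono:
  assumes "0 \<le> y" "y < z"
  shows "less_fun (omega lam y) (omega lam z)"
  using omega_mono[of y z] omega_injective[of y z] assms by auto

section \<open>The coding of infinity\<close>

text \<open>
Once the earlier digits have stabilised, the next one is a monotone function of the point with values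
in a finite set.
\<close>

lemma omega_digit_eventually_const: "\<exists>c. \<forall>\<^sub>F x in at_top. omega lam x n = c"
proof (induction n rule: less_induct)
  case (less n)
  then obtain c where c: "\<And>j. j < n \<Longrightarrow> \<forall>\<^sub>F x in at_top. omega lam x j = c j" by metis
  then have "\<forall>\<^sub>F x in at_top. \<forall>j\<in>{..<n}. omega lam x j = c j"
    by (intro eventually_ball_finite) auto
  then obtain B where B: "\<And>x j. B \<le> x \<Longrightarrow> j < n \<Longrightarrow> omega lam x j = c j"
    by (auto simp: eventually_at_top_linorder)
  define S where "S = (\<lambda>x. omega lam x n) ` {max 0 B..}"
  have "S \<subseteq> {..i_last lam}"
    using digit_props(1) orbit_nonneg by (auto simp: S_def omega_def)
  then have fin: "finite S" using finite_subset by blast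
  then have "Max S \<in> S" by (intro Max_in) (auto simp: S_def)
  then obtain x0 where x0: "max 0 B \<le> x0" "Max S = omega lam x0 n" by (auto simp: S_def)
  have "omega lam x n = Max S" if "x0 \<le> x" for x
  proof (rule antisym)
    show "omega lam x n \<le> Max S" using fin x0 that by (intro Max_ge) (auto simp: S_def)
    have agree: "omega lam x0 j = omega lam x j" if "j < n" for j
      using B that x0 \<open>x0 \<le> x\<close> by simp
    show "Max S \<le> omega lam x n"
    proof (cases "x0 = x")
      case False
      with that x0 have "(T lam ^^ n) x0 < (T lam ^^ n) x"
        by (intro orbit_less agree) auto
      then show ?thesis
        unfolding x0(2) omega_def using x0 orbit_nonneg by (intro digit_mono) auto
    qed (use x0 in simp)
  qed
  then show ?case unfolding eventually_at_top_linorder by blast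
qed

lemma omega_infinity_eventually: "\<forall>\<^sub>F x in at_top. \<forall>j\<le>n. omega lam x j = omega_infinity lam j"
proof -
  obtain w where "\<And>j. \<forall>\<^sub>F x in at_top. omega lam x j = w j"
    using omega_digit_eventually_const by metis
  then have "\<forall>\<^sub>F x in at_top. \<forall>j\<in>{..n}. omega lam x j = w j" for n
    by (intro eventually_ball_finite) auto
  then have w: "\<forall>n. \<forall>\<^sub>F x in at_top. \<forall>j\<le>n. omega lam x j = w j"
    by (simp add: Ball_def)
  have "omega_infinity lam = w"
    unfolding omega_infinity_def
  proof (rule the_equality)
    show "\<forall>n. \<forall>\<^sub>F x in at_top. \<forall>j\<le>n. omega lam x j = w j" by (rule w)
  next
    fix v assume v: "\<forall>n. \<forall>\<^sub>F x in at_top. \<forall>j\<le>n. omega lam x j = v j"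
    show "v = w"
    proof
      fix n
      have "\<forall>\<^sub>F x::real in at_top. v n = w n"
        using w[rule_format, of n] v[rule_format, of n] by eventually_elim force
      then show "v n = w n" by simp
    qed
  qed
  with w show ?thesis by blast
qed

text \<open>
Monotonicity alone gives only a weak inequality; comparing with the point $y+1$ makes it strict.
\<close>

lemma omega_less_infinity:
  assumes "0 \<le> y"
  shows "less_fun (omega lam y) (omega_infinity lam)"
proof -
  obtain l where l: "omega lam y l < omega lam (y + 1) l"
      "\<And>j. j < l \<Longrightarrow> omega lam y j = omega lam (y + 1) j"
    using omega_strict_mono[of y "y + 1"] assms unfolding less_fun_def by auto
  obtain B where B: "\<And>x j. B \<le> x \<Longrightarrow> j \<le> l \<Longrightarrow> omega lam x j = omega_infinity lam j"
    using omega_infinity_eventually[of l] by (auto simp: eventually_at_top_linorder)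
  show ?thesis
  proof (rule less_fun_prefix_limit[where v' = "omega lam (max B (y + 1))"])
    show "lex_le (omega lam (y + 1)) (omega lam (max B (y + 1)))"
      using assms by (intro omega_mono) auto
  qed (use l B in auto)
qed

section \<open>Realising an admissible sequence\<close>

definition points_below :: "(nat \<Rightarrow> nat) \<Rightarrow> real set" where
  "points_below x = {t. 0 \<le> t \<and> lex_le (omega lam t) x}"

lemma points_below_bounded:
  assumes "less_fun x (omega_infinity lam)"
  shows "bdd_above (points_below x)"
proof -
  obtain l where l: "x l < omega_infinity lam l" "\<forall>j<l. x j = omega_infinity lam j"
    using assms unfolding less_fun_def by blast
  obtain B where B: "\<And>t j. B \<le> t \<Longrightarrow> j \<le> l \<Longrightarrow> omega lam t j = omega_infinity lam j"
    using omega_infinity_eventually[of l] by (auto simp: eventually_at_top_linorder)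
  have "t \<le> B" if "t \<in> points_below x" for t
  proof (rule ccontr)
    assume "\<not> t \<le> B"
    then have "less_fun x (omega lam t)"
      unfolding less_fun_def using l B by (intro exI[of _ l]) auto
    moreover have "lex_le (omega lam t) x" using that by (simp add: points_below_def)
    ultimately show False using less_fun_asym less_fun_irrefl by blast
  qed
  then show ?thesis by (rule bdd_aboveI)
qed

lemma zero_in_points_below: "0 \<in> points_below x"
proof -
  have "\<not> less_fun x (omega lam 0)" by (simp add: less_fun_def omega_0_const)
  then show ?thesis unfolding points_below_def using lex_total by blast
qed

lemma points_below_down_closed:
  assumes "t \<in> points_below x" "0 \<le> s" "s \<le> t"
  shows "s \<in> points_below x"
  using assms omega_mono[of s t] less_fun_trans unfolding points_below_def by fastforce

lemma points_below_less_Sup: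
  assumes "0 \<le> t" "t < Sup (points_below x)"
  shows "t \<in> points_below x"
proof -
  obtain e where "e \<in> points_below x" "t < e"
    using less_cSupD[OF _ assms(2)] zero_in_points_below by blast
  then show ?thesis using assms(1) points_below_down_closed by simp
qed

text \<open>
Peeling off the first digit of the lexicographic order: this self-similarity of the sets of points
below a sequence drives the whole construction.
\<close>

lemma points_below_head_tail:
  "t \<in> points_below x \<longleftrightarrow> 0 \<le> t \<and> (digit lam t < x 0 \<or>
     digit lam t = x 0 \<and> T lam t \<in> points_below (\<lambda>k. x (Suc k)))"
  using T_nonneg[of t] lex_le_head_tail[of "omega lam t" x]
  by (auto simp: points_below_def omega_0 omega_Suc)

lemma in_dom_down_closed:
  assumes "i \<le> i_last lam" "in_dom i y" "0 \<le> s" "s \<le> y"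
  shows "in_dom i s"
proof (cases "0 \<le> cheb lam (Suc (Suc i))")
  case True
  then show ?thesis using assms cheb_Suc_pos[of i] by (simp add: in_dom_def add_nonneg_pos del: cheb.simps)
next
  case False
  then have "cheb lam (Suc (Suc i)) * y \<le> cheb lam (Suc (Suc i)) * s"
    using assms by (intro mult_left_mono_neg) auto
  then show ?thesis using assms by (simp add: in_dom_def del: cheb.simps)
qed

definition admissible :: "(nat \<Rightarrow> nat) \<Rightarrow> bool" where
  "admissible x \<longleftrightarrow> (\<forall>n. less_fun (\<lambda>k. x (n + k)) (omega_infinity lam))"

lemma admissible_less: "admissible x \<Longrightarrow> less_fun x (omega_infinity lam)"
  unfolding admissible_def by (drule spec[of _ 0]) simp

lemma admissible_tail:
  assumes "admissible x"
  shows "admissible (\<lambda>k. x (Suc k))"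
  unfolding admissible_def
proof
  fix n
  show "less_fun (\<lambda>k. x (Suc (n + k))) (omega_infinity lam)"
    using assms[unfolded admissible_def, rule_format, of "Suc n"] by simp
qed

lemma admissible_bounded: "admissible x \<Longrightarrow> bdd_above (points_below x)"
  by (intro points_below_bounded admissible_less)

lemma admissible_head_le:
  assumes "admissible x"
  shows "x 0 \<le> i_last lam"
proof -
  have "x 0 \<le> omega_infinity lam 0"
    using admissible_less[OF assms] less_fun_head_tail[of x "omega_infinity lam"] by auto
  also obtain B where "\<forall>t\<ge>B. omega lam t 0 = omega_infinity lam 0"
    using omega_infinity_eventually[of 0] by (auto simp: eventually_at_top_linorder)
  then have "omega_infinity lam 0 = digit lam (max 0 B)" by (metis max.cobounded2 omega_0)
  also have "\<dots> \<le> i_last lam" by (intro digit_props) simp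
  finally show ?thesis .
qed

text \<open>
The supremum $s$ for the tail has to lie in the domain of the branch $h_{x_0}$ before the supremum
for $x$ can be identified with $h_{x_0}(s)$. Only the last branch is at issue. If $s$ were not in its
domain, the points below the tail would fill the whole domain, hence every nonnegative real would be
a point below $x$, contradicting that $x \prec \omega_\lambda(\infty)$ bounds those points.
\<close>

lemma Sup_points_below_step:
  assumes "admissible x"
  shows "digit lam (Sup (points_below x)) = x 0"
    and "T lam (Sup (points_below x)) = Sup (points_below (\<lambda>k. x (Suc k)))"
proof -
  define i where "i = x 0"
  define x' where "x' = (\<lambda>k. x (Suc k))"
  define s where "s = Sup (points_below x')"
  have i: "i \<le> i_last lam" using admissible_head_le assms by (simp add: i_def)
  have bdd: "bdd_above (points_below x)" "bdd_above (points_below x')"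
    using assms admissible_tail admissible_bounded by (auto simp: x'_def)
  have mem: "t \<in> points_below x \<longleftrightarrow>
      0 \<le> t \<and> (digit lam t < i \<or> digit lam t = i \<and> T lam t \<in> points_below x')" for t
    unfolding i_def x'_def by (rule points_below_head_tail)
  have s0: "0 \<le> s" unfolding s_def using bdd zero_in_points_below by (intro cSup_upper)
  have below_s: "t \<in> points_below x'" if "0 \<le> t" "t < s" for t
    using that points_below_less_Sup by (simp add: s_def)
  have dom: "in_dom i s"
  proof (rule ccontr)
    assume nd: "\<not> in_dom i s"
    have last: "i = i_last lam"
    proof (rule ccontr)
      assume "i \<noteq> i_last lam"
      with i have "0 < cheb lam (Suc i)" "0 < cheb lam (Suc (Suc i))"
        using cheb_Suc_pos[of i] cheb_Suc_pos[of "Suc i"] by auto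
      with nd s0 show False by (simp add: in_dom_def add_nonneg_pos del: cheb.simps)
    qed
    have all: "t \<in> points_below x" if t: "0 \<le> t" for t
    proof (cases "digit lam t = i")
      case True
      then have "T lam t < s"
        using branch_T(1)[OF t] in_dom_down_closed[OF i _ s0] nd by (metis not_le)
      then show ?thesis using True t below_s T_nonneg mem by blast
    next
      case False
      then show ?thesis using digit_props(1)[OF t] last mem t by simp
    qed
    obtain B where "\<And>t. t \<in> points_below x \<Longrightarrow> t \<le> B" using bdd(1) unfolding bdd_above_def by blast
    from this[OF all, of "max 0 B + 1"] show False by simp
  qed
  define v where "v = branch lam i s"
  have v: "digit lam v = i" "T lam v = s" using T_branch[OF i dom] by (auto simp: v_def)
  have v0: "0 \<le> v" using branch_in_interval[OF i dom] interval_iff[OF i] by (auto simp: v_def)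
  have "Sup (points_below x) = v"
  proof (rule cSup_eq_non_empty)
    show "points_below x \<noteq> {}" using zero_in_points_below by blast
    show "t \<le> v" if t: "t \<in> points_below x" for t
    proof (rule ccontr)
      assume "\<not> t \<le> v"
      then have lt: "v < t" by simp
      have "i \<le> digit lam t" using digit_mono[OF v0, of t] lt v by simp
      then have dt: "digit lam t = i" and "T lam t \<in> points_below x'" using t mem by auto
      then have "T lam t \<le> s" unfolding s_def using bdd by (intro cSup_upper)
      moreover have "s < T lam t" using T_less[OF v0 lt] dt v by simp
      ultimately show False by simp
    qed
    show "v \<le> y" if y: "\<And>t. t \<in> points_below x \<Longrightarrow> t \<le> y" for y
    proof (rule ccontr)
      assume "\<not> v \<le> y"
      define t where "t = (y + v) / 2"
      have t: "0 \<le> t" "y < t" "t < v"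
        using y[OF zero_in_points_below] \<open>\<not> v \<le> y\<close> by (auto simp: t_def)
      have "t \<in> points_below x"
      proof (cases "digit lam t = i")
        case True
        then have "T lam t < s" using T_less[OF t(1,3)] v by simp
        then show ?thesis using True t below_s T_nonneg mem by blast
      next
        case False
        then have "digit lam t < i" using digit_mono[of t v] t v by simp
        then show ?thesis using t mem by simp
      qed
      then show False using y t by force
    qed
  qed
  then show "digit lam (Sup (points_below x)) = x 0"
    and "T lam (Sup (points_below x)) = Sup (points_below (\<lambda>k. x (Suc k)))"
    using v by (simp_all add: i_def s_def x'_def)
qed

lemma omega_Sup_points_below: "admissible x \<Longrightarrow> omega lam (Sup (points_below x)) n = x n"
proof (induction n arbitrary: x)
  case 0
  then show ?case using Sup_points_below_step(1) by (simp add: omega_0)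
next
  case (Suc n)
  then show ?case
    using Sup_points_below_step(2)[OF Suc.prems] Suc.IH[OF admissible_tail[OF Suc.prems]]
    by (simp add: omega_Suc)
qed

lemma admissible_omega: "0 \<le> y \<Longrightarrow> admissible (omega lam y)"
  unfolding admissible_def using omega_less_infinity[OF orbit_nonneg]
  by (simp add: omega_orbit[symmetric])

lemma coding_iff_admissible: "(\<exists>y\<ge>0. omega lam y = x) \<longleftrightarrow> admissible x"
proof
  assume adm: "admissible x"
  then have "0 \<le> Sup (points_below x)"
    using admissible_bounded zero_in_points_below by (intro cSup_upper)
  moreover have "omega lam (Sup (points_below x)) = x"
    using omega_Sup_points_below[OF adm] by auto
  ultimately show "\<exists>y\<ge>0. omega lam y = x" by blast
qed (use admissible_omega in blast)

end

theorem theorem4p4: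
  fixes lam :: real and x :: "nat \<Rightarrow> nat"
  assumes "0 < lam" and "lam < 2"
  shows "(\<exists>y\<ge>0. omega lam y = x) \<longleftrightarrow>
         (\<forall>n. less_fun (\<lambda>k. x (n + k)) (omega_infinity lam))"
  by (rule coding_iff_admissible[OF assms, unfolded admissible_def[OF assms]])

end
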